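(* For any split-generated category with weak equivalences $(\mathcal{C},\mathcal{W})$ which satisfies the "common fork" condition, the homotopy relation $\sim_{\mathcal{W}}$ coincides with the relations $R_\ell^c$ and $R_r^c$.
   Context: A category with weak equivalences is a pair $(\mathcal{C},\mathcal{W})$ where $\mathcal{W}$ is a family of arrows of the category $\mathcal{C}$ (the weak equivalences) containing all identities and having the two out of three property: for composable $f,g$, if two of $f,g,gf$ are in $\mathcal{W}$ then so is the third. An arrow splits if it is a section (has a left inverse) or a retraction (has a right inverse). $(\mathcal{C},\mathcal{W})$ is split-generated if every arrow of $\mathcal{W}$ is a (finite) composition of weak equivalences that split. Let $\gamma:\mathcal{C}\to Ho(\mathcal{C})$ be the localization of $\mathcal{C}$ with respect to $\mathcal{W}$ (the universal functor sending arrows of $\mathcal{W}$ to isomorphisms; size issues are ignored). The homotopy relation $\sim_{\mathcal{W}}$ relates parallel arrows $f,g$ if and only if $\gamma f=\gamma g$. For parallel arrows $f,g:A\to B$: - $f\,R_\ell^c\,g$ if and only if there are objects $C,\widetilde{A}$ and arrows $\alpha:A\to C$, $\partial_0,\partial_1:A\to\widetilde{A}$, $\sigma:\widetilde{A}\to C$, $h:\widetilde{A}\to B$ with $\sigma$ a weak equivalence, $\sigma\partial_0=\sigma\partial_1=\alpha$, $h\partial_0=f$ and $h\partial_1=g$. - $f\,R_r^c\,g$ if and only if there are objects $C,\widetilde{B}$ and arrows $\beta:C\to B$, $d_0,d_1:\widetilde{B}\to B$, $s:C\to\widetilde{B}$, $k:A\to\widetilde{B}$ with $s$ a weak equivalence,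 $d_0s=d_1s=\beta$, $d_0k=f$ and $d_1k=g$. A left fork of weak equivalences with vertex $A$ consists of arrows $\alpha:A\to C$, $\partial_0,\partial_1:A\to\widetilde{A}$, $\sigma:\widetilde{A}\to C$ with $\sigma\partial_0=\sigma\partial_1=\alpha$ and $\sigma,\alpha$ weak equivalences; a left homotopy between $f,g:A\to B$ with respect to it is $h:\widetilde{A}\to B$ with $h\partial_0=f$, $h\partial_1=g$. A right fork of weak equivalences with vertex $B$ consists of arrows $\beta:C\to B$, $d_0,d_1:\widetilde{B}\to B$, $s:C\to\widetilde{B}$ with $d_0s=d_1s=\beta$ and $s,\beta$ weak equivalences; a right homotopy between $f,g:A\to B$ with respect to it is $k:A\to\widetilde{B}$ with $d_0k=f$, $d_1k=g$. $(\mathcal{C},\mathcal{W})$ satisfies the "common fork" condition if, for all arrows $f,g,f',g':A\to B$: whenever $f\,R_\ell^c\,g$ and $f'\,R_\ell^c\,g'$, there is one left fork of weak equivalences with vertex $A$ with respect to which there are both a left homotopy between $f$ and $g$ and a left homotopy between $f'$ and $g'$; and whenever $f\,R_r^c\,g$ and $f'\,R_r^c\,g'$, there is one right fork of weak equivalences with vertex $B$ with respect to which there are both a right homotopy between $f$ and $g$ and a right homotopy between $f'$ and $g'$. *)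

theory Defs
  imports Main
begin

section \<open>Categories and functors\<close>

text \<open>Composition is written in applicative order: \<open>Comp C g f\<close> is \<open>g\<close> after \<open>f\<close>.
  The operations are unconstrained outside \<open>Obj\<close>, \<open>Arr\<close> and composable pairs.\<close>

record ('o, 'a) cat =
  Obj :: "'o set"
  Arr :: "'a set"
  Dom :: "'a \<Rightarrow> 'o"
  Cod :: "'a \<Rightarrow> 'o"
  Id :: "'o \<Rightarrow> 'a"
  Comp :: "'a \<Rightarrow> 'a \<Rightarrow> 'a" (infixr "\<cdot>\<index>" 70)

definition Hom :: "('o, 'a) cat \<Rightarrow> 'o \<Rightarrow> 'o \<Rightarrow> 'a set" where
  "Hom C A B = {f \<in> Arr C. Dom C f = A \<and> Cod C f = B}"

locale category =
  fixes C :: "('o, 'a) cat" (structure)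
  assumes Dom_in_Obj: "f \<in> Arr C \<Longrightarrow> Dom C f \<in> Obj C"
    and Cod_in_Obj: "f \<in> Arr C \<Longrightarrow> Cod C f \<in> Obj C"
    and Id_in_Hom: "A \<in> Obj C \<Longrightarrow> Id C A \<in> Hom C A A"
    and Comp_in_Hom: "f \<in> Hom C A B \<Longrightarrow> g \<in> Hom C B D \<Longrightarrow> g \<cdot> f \<in> Hom C A D"
    and Comp_Id_right: "f \<in> Hom C A B \<Longrightarrow> f \<cdot> Id C A = f"
    and Comp_Id_left: "f \<in> Hom C A B \<Longrightarrow> Id C B \<cdot> f = f"
    and Comp_assoc: "f \<in> Hom C A B \<Longrightarrow> g \<in> Hom C B D \<Longrightarrow> h \<in> Hom C D E \<Longrightarrow>
      (h \<cdot> g) \<cdot> f = h \<cdot> (g \<cdot> f)"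

definition inverse_arrows :: "('o, 'a) cat \<Rightarrow> 'a \<Rightarrow> 'a \<Rightarrow> bool" where
  "inverse_arrows C f g \<longleftrightarrow>
    (\<exists>A B. f \<in> Hom C A B \<and> g \<in> Hom C B A \<and> Comp C g f = Id C A \<and> Comp C f g = Id C B)"

definition isomorphism :: "('o, 'a) cat \<Rightarrow> 'a \<Rightarrow> bool" where
  "isomorphism C f \<longleftrightarrow> (\<exists>g. inverse_arrows C f g)"

locale cat_functor = dom: category C + cod: category D
  for C :: "('o, 'a) cat" and D :: "('p, 'b) cat" +
  fixes Fo :: "'o \<Rightarrow> 'p" and Fa :: "'a \<Rightarrow> 'b"
  assumes map_Obj: "A \<in> Obj C \<Longrightarrow> Fo A \<in> Obj D"
    and map_Hom: "f \<in> Hom C A B \<Longrightarrow> Fa f \<in> Hom D (Fo A) (Fo B)"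
    and map_Id: "A \<in> Obj C \<Longrightarrow> Fa (Id C A) = Id D (Fo A)"
    and map_Comp: "f \<in> Hom C A B \<Longrightarrow> g \<in> Hom C B E \<Longrightarrow>
      Fa (Comp C g f) = Comp D (Fa g) (Fa f)"


section \<open>Categories with weak equivalences\<close>

locale weq_category = category C for C :: "('o, 'a) cat" (structure) +
  fixes W :: "'a set"
  assumes W_Arr: "W \<subseteq> Arr C"
    and Id_W: "A \<in> Obj C \<Longrightarrow> Id C A \<in> W"
    and Comp_W: "f \<in> Hom C A B \<Longrightarrow> g \<in> Hom C B D \<Longrightarrow> f \<in> W \<Longrightarrow> g \<in> W \<Longrightarrow> g \<cdot> f \<in> W"
    and left_cancel_W: "f \<in> Hom C A B \<Longrightarrow> g \<in> Hom C B D \<Longrightarrow> g \<in> W \<Longrightarrow> g \<cdot> f \<in> W \<Longrightarrow> f \<in> W"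
    and right_cancel_W: "f \<in> Hom C A B \<Longrightarrow> g \<in> Hom C B D \<Longrightarrow> f \<in> W \<Longrightarrow> g \<cdot> f \<in> W \<Longrightarrow> g \<in> W"

definition is_section :: "('o, 'a) cat \<Rightarrow> 'a \<Rightarrow> bool" where
  "is_section C f \<longleftrightarrow> (\<exists>A B r. f \<in> Hom C A B \<and> r \<in> Hom C B A \<and> Comp C r f = Id C A)"

definition is_retraction :: "('o, 'a) cat \<Rightarrow> 'a \<Rightarrow> bool" where
  "is_retraction C f \<longleftrightarrow> (\<exists>A B s. f \<in> Hom C A B \<and> s \<in> Hom C B A \<and> Comp C f s = Id C B)"

definition splits :: "('o, 'a) cat \<Rightarrow> 'a \<Rightarrow> bool" where
  "splits C f \<longleftrightarrow> is_section C f \<or> is_retraction C f"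

text \<open>The empty composition needs no separate clause: identities are weak equivalences that split.\<close>

inductive_set split_comps :: "('o, 'a) cat \<Rightarrow> 'a set \<Rightarrow> 'a set"
  for C :: "('o, 'a) cat" and W :: "'a set" where
  single: "f \<in> W \<Longrightarrow> splits C f \<Longrightarrow> f \<in> split_comps C W"
| comp: "f \<in> split_comps C W \<Longrightarrow> f \<in> Hom C A B \<Longrightarrow> g \<in> Hom C B D \<Longrightarrow> g \<in> W \<Longrightarrow> splits C g \<Longrightarrow>
    Comp C g f \<in> split_comps C W"

definition split_generated :: "('o, 'a) cat \<Rightarrow> 'a set \<Rightarrow> bool" where
  "split_generated C W \<longleftrightarrow> W \<subseteq> split_comps C W"


section \<open>The localization\<close>

text \<open>Zigzags are the arrows of the free category on the arrows of \<open>C\<close> (\<open>Fwd f\<close>) together with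
  a formal inverse \<open>Bwd w\<close> for each \<open>w \<in> W\<close>; a list is read in diagrammatic order.
  The localization is the quotient of this free category by the congruence \<open>zeq\<close>; that it
  has the universal property, with respect to target categories of arbitrary type, is proved
  at the end of this section.\<close>

datatype 'a letter = Fwd 'a | Bwd 'a

inductive zigzag :: "('o, 'a) cat \<Rightarrow> 'a set \<Rightarrow> 'o \<Rightarrow> 'a letter list \<Rightarrow> 'o \<Rightarrow> bool"
  for C :: "('o, 'a) cat" and W :: "'a set" where
  Nil: "A \<in> Obj C \<Longrightarrow> zigzag C W A [] A"
| Fwd: "f \<in> Hom C A B \<Longrightarrow> zigzag C W B p D \<Longrightarrow> zigzag C W A (Fwd f # p) D"
| Bwd: "w \<in> W \<Longrightarrow> w \<in> Hom C B A \<Longrightarrow> zigzag C W B p D \<Longrightarrow> zigzag C W A (Bwd w # p) D"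

inductive zeq ::
  "('o, 'a) cat \<Rightarrow> 'a set \<Rightarrow> 'o \<Rightarrow> 'o \<Rightarrow> 'a letter list \<Rightarrow> 'a letter list \<Rightarrow> bool"
  for C :: "('o, 'a) cat" and W :: "'a set" where
  id: "A \<in> Obj C \<Longrightarrow> zeq C W A A [Fwd (Id C A)] []"
| comp: "f \<in> Hom C A B \<Longrightarrow> g \<in> Hom C B D \<Longrightarrow> zeq C W A D [Fwd f, Fwd g] [Fwd (Comp C g f)]"
| inv_right: "w \<in> W \<Longrightarrow> w \<in> Hom C A B \<Longrightarrow> zeq C W A A [Fwd w, Bwd w] []"
| inv_left: "w \<in> W \<Longrightarrow> w \<in> Hom C A B \<Longrightarrow> zeq C W B B [Bwd w, Fwd w] []"
| refl: "zigzag C W A p B \<Longrightarrow> zeq C W A B p p"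
| sym: "zeq C W A B p q \<Longrightarrow> zeq C W A B q p"
| trans: "zeq C W A B p q \<Longrightarrow> zeq C W A B q r \<Longrightarrow> zeq C W A B p r"
| cong: "zeq C W A B p p' \<Longrightarrow> zeq C W B D q q' \<Longrightarrow> zeq C W A D (p @ q) (p' @ q')"

type_synonym ('o, 'a) ho_arrow = "'o \<times> 'a letter list set \<times> 'o"

definition zclass ::
  "('o, 'a) cat \<Rightarrow> 'a set \<Rightarrow> 'o \<Rightarrow> 'o \<Rightarrow> 'a letter list \<Rightarrow> ('o, 'a) ho_arrow" where
  "zclass C W A B p = (A, {q. zeq C W A B p q}, B)"

definition Ho :: "('o, 'a) cat \<Rightarrow> 'a set \<Rightarrow> ('o, ('o, 'a) ho_arrow) cat" where
  "Ho C W = \<lparr>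
    Obj = Obj C,
    Arr = {zclass C W A B p | A B p. zigzag C W A p B},
    Dom = (\<lambda>(A, P, B). A),
    Cod = (\<lambda>(A, P, B). B),
    Id = (\<lambda>A. zclass C W A A []),
    Comp = (\<lambda>(B', Q, D) (A, P, B). (A, {r. \<exists>p\<in>P. \<exists>q\<in>Q. zeq C W A D (p @ q) r}, D))\<rparr>"

text \<open>The localization functor, given on arrows; it is the identity on objects.\<close>

definition loc :: "('o, 'a) cat \<Rightarrow> 'a set \<Rightarrow> 'a \<Rightarrow> ('o, 'a) ho_arrow" where
  "loc C W f = zclass C W (Dom C f) (Cod C f) [Fwd f]"

lemma HomD:
  assumes "f \<in> Hom C A B"
  shows "f \<in> Arr C" "Dom C f = A" "Cod C f = B"
  using assms by (auto simp: Hom_def)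

lemma inverse_arrows_Hom:
  assumes "inverse_arrows C f g" "f \<in> Hom C A B"
  shows "g \<in> Hom C B A" "Comp C g f = Id C A" "Comp C f g = Id C B"
  using assms by (auto simp: inverse_arrows_def Hom_def)

context category
begin

lemma Hom_Obj:
  assumes "f \<in> Hom C A B"
  shows "A \<in> Obj C" "B \<in> Obj C"
  using assms Dom_in_Obj Cod_in_Obj by (auto simp: Hom_def)

lemma inverse_arrows_unique:
  assumes g: "inverse_arrows C f g" and h: "inverse_arrows C f h"
  shows "g = h"
proof -
  obtain A B where f: "f \<in> Hom C A B" using g by (auto simp: inverse_arrows_def)
  note G = inverse_arrows_Hom[OF g f] and H = inverse_arrows_Hom[OF h f]
  have "g = (h \<cdot> f) \<cdot> g" using G(1) H(2) Comp_Id_left by simp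
  also have "\<dots> = h \<cdot> (f \<cdot> g)" using G(1) f H(1) by (rule Comp_assoc)
  also have "\<dots> = h" using G(3) H(1) Comp_Id_right by simp
  finally show ?thesis .
qed

lemma zigzag_Obj: "zigzag C W A p B \<Longrightarrow> A \<in> Obj C \<and> B \<in> Obj C"
  by (induction rule: zigzag.induct) (auto dest: Hom_Obj)

lemma zigzag_append: "zigzag C W A p B \<Longrightarrow> zigzag C W B q D \<Longrightarrow> zigzag C W A (p @ q) D"
  by (induction rule: zigzag.induct) (auto intro: zigzag.intros)

lemma zigzag_single:
  "f \<in> Hom C A B \<Longrightarrow> zigzag C W A [Fwd f] B"
  "w \<in> W \<Longrightarrow> w \<in> Hom C A B \<Longrightarrow> zigzag C W B [Bwd w] A"
  by (meson Hom_Obj zigzag.intros)+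

lemma zeq_zigzag: "zeq C W A B p q \<Longrightarrow> zigzag C W A p B \<and> zigzag C W A q B"
  by (induction rule: zeq.induct)
    (blast intro: zigzag.intros zigzag_single zigzag_append Id_in_Hom Comp_in_Hom dest: Hom_Obj)+

lemma zclass_eq:
  assumes "zigzag C W A p B"
  shows "zclass C W A B p = zclass C W A' B' q \<longleftrightarrow> A = A' \<and> B = B' \<and> zeq C W A B p q"
  using assms unfolding zclass_def
  by (auto intro: zeq.refl zeq.sym zeq.trans simp: set_eq_iff)

lemma zclass_Hom: "zigzag C W A p B \<Longrightarrow> zclass C W A B p \<in> Hom (Ho C W) A B"
  unfolding Hom_def Ho_def by (auto simp: zclass_def)

lemma Ho_HomE:
  assumes "x \<in> Hom (Ho C W) A B"
  obtains p where "x = zclass C W A B p" "zigzag C W A p B"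
  using assms unfolding Hom_def Ho_def by (auto simp: zclass_def)

lemma zclass_Comp:
  assumes "zigzag C W A p B" "zigzag C W B q D"
  shows "Comp (Ho C W) (zclass C W B D q) (zclass C W A B p) = zclass C W A D (p @ q)"
proof -
  have "(\<exists>p'. zeq C W A B p p' \<and> (\<exists>q'. zeq C W B D q q' \<and> zeq C W A D (p' @ q') r)) \<longleftrightarrow>
    zeq C W A D (p @ q) r" for r
    using assms by (meson zeq.cong zeq.refl zeq.trans)
  then show ?thesis by (simp add: Ho_def zclass_def)
qed

lemma Ho_category: "category (Ho C W)"
proof
  fix x assume "x \<in> Arr (Ho C W)"
  then show "Dom (Ho C W) x \<in> Obj (Ho C W)" "Cod (Ho C W) x \<in> Obj (Ho C W)"
    by (auto simp: Ho_def zclass_def dest: zigzag_Obj)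
next
  fix A assume "A \<in> Obj (Ho C W)"
  then have "zigzag C W A [] A" by (simp add: Ho_def zigzag.Nil)
  then show "Id (Ho C W) A \<in> Hom (Ho C W) A A"
    using zclass_Hom by (fastforce simp: Ho_def)
next
  fix x A B y D assume "x \<in> Hom (Ho C W) A B" "y \<in> Hom (Ho C W) B D"
  then show "Comp (Ho C W) y x \<in> Hom (Ho C W) A D"
    by (elim Ho_HomE) (simp add: zclass_Comp zclass_Hom zigzag_append)
next
  fix x A B assume "x \<in> Hom (Ho C W) A B"
  then obtain p where p: "x = zclass C W A B p" "zigzag C W A p B" by (rule Ho_HomE)
  have I: "Id (Ho C W) E = zclass C W E E []" for E by (simp add: Ho_def)
  have "zigzag C W A [] A" "zigzag C W B [] B" using p zigzag_Obj zigzag.Nil by metis+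
  then show "Comp (Ho C W) x (Id (Ho C W) A) = x" "Comp (Ho C W) (Id (Ho C W) B) x = x"
    using p by (simp_all add: I zclass_Comp)
next
  fix x A B y D z E
  assume "x \<in> Hom (Ho C W) A B" "y \<in> Hom (Ho C W) B D" "z \<in> Hom (Ho C W) D E"
  then show "Comp (Ho C W) (Comp (Ho C W) z y) x = Comp (Ho C W) z (Comp (Ho C W) y x)"
    by (elim Ho_HomE) (simp add: zclass_Comp zigzag_append)
qed

lemma loc_Hom_eq: "f \<in> Hom C A B \<Longrightarrow> loc C W f = zclass C W A B [Fwd f]"
  by (simp add: loc_def Hom_def)

theorem loc_functor: "cat_functor C (Ho C W) (\<lambda>A. A) (loc C W)"
proof (intro cat_functor.intro Ho_category cat_functor_axioms.intro)
  show "category C" ..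
next
  fix A assume A: "A \<in> Obj C"
  then show "A \<in> Obj (Ho C W)" by (simp add: Ho_def)
  show "loc C W (Id C A) = Id (Ho C W) A"
    using loc_Hom_eq[OF Id_in_Hom[OF A]] zigzag_single(1)[OF Id_in_Hom[OF A]] zeq.id[OF A]
    by (simp add: Ho_def zclass_eq)
next
  fix f A B assume f: "f \<in> Hom C A B"
  then show "loc C W f \<in> Hom (Ho C W) A B"
    by (simp add: loc_Hom_eq zclass_Hom zigzag_single)
  fix g E assume g: "g \<in> Hom C B E"
  have "zigzag C W A [Fwd (g \<cdot> f)] E" using Comp_in_Hom[OF f g] by (rule zigzag_single)
  then show "loc C W (g \<cdot> f) = Comp (Ho C W) (loc C W g) (loc C W f)"
    using zeq.sym[OF zeq.comp[OF f g]]
    by (simp add: loc_Hom_eq[OF f] loc_Hom_eq[OF g] loc_Hom_eq[OF Comp_in_Hom[OF f g]]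
        zclass_Comp zigzag_single[OF f] zigzag_single[OF g] zclass_eq)
qed

lemma loc_inverse:
  assumes w: "w \<in> W" "w \<in> Hom C A B"
  shows "inverse_arrows (Ho C W) (loc C W w) (zclass C W B A [Bwd w])"
proof -
  note z = zigzag_single(1)[OF w(2)] zigzag_single(2)[where W=W, OF w]
  have "Comp (Ho C W) (zclass C W B A [Bwd w]) (loc C W w) = Id (Ho C W) A"
    using z zeq.inv_right[OF w] zigzag_append[OF z(1,2)]
    by (simp add: loc_Hom_eq[OF w(2)] zclass_Comp) (simp add: Ho_def zclass_eq)
  moreover have "Comp (Ho C W) (loc C W w) (zclass C W B A [Bwd w]) = Id (Ho C W) B"
    using z zeq.inv_left[OF w] zigzag_append[OF z(2,1)]
    by (simp add: loc_Hom_eq[OF w(2)] zclass_Comp) (simp add: Ho_def zclass_eq)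
  ultimately show ?thesis
    unfolding inverse_arrows_def using z zclass_Hom loc_Hom_eq[OF w(2)] by metis
qed

end

theorem (in weq_category) loc_inverts: "w \<in> W \<Longrightarrow> isomorphism (Ho C W) (loc C W w)"
  using W_Arr loc_inverse unfolding isomorphism_def Hom_def by blast

text \<open>The value of a functor that inverts \<open>W\<close> on a zigzag with a given source.\<close>

fun zeval :: "('o, 'a) cat \<Rightarrow> ('p, 'b) cat \<Rightarrow> ('o \<Rightarrow> 'p) \<Rightarrow> ('a \<Rightarrow> 'b) \<Rightarrow> 'o \<Rightarrow> 'a letter list \<Rightarrow> 'b"
where
  "zeval C D Fo Fa A [] = Id D (Fo A)"
| "zeval C D Fo Fa A (Fwd f # p) = Comp D (zeval C D Fo Fa (Cod C f) p) (Fa f)"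
| "zeval C D Fo Fa A (Bwd w # p) =
    Comp D (zeval C D Fo Fa (Dom C w) p) (THE v. inverse_arrows D (Fa w) v)"

context cat_functor
begin

lemma The_inverse:
  assumes "isomorphism D (Fa w)"
  shows "inverse_arrows D (Fa w) (THE v. inverse_arrows D (Fa w) v)"
  using assms unfolding isomorphism_def
  by (metis (mono_tags, lifting) cod.inverse_arrows_unique the_equality)

lemma The_inverse_Hom:
  assumes "isomorphism D (Fa w)" "w \<in> Hom C A B"
  shows "(THE v. inverse_arrows D (Fa w) v) \<in> Hom D (Fo B) (Fo A)"
  using inverse_arrows_Hom(1)[OF The_inverse[OF assms(1)] map_Hom[OF assms(2)]] .

lemma zeval_Hom:
  assumes inv: "\<And>w. w \<in> W \<Longrightarrow> isomorphism D (Fa w)"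
  shows "zigzag C W A p B \<Longrightarrow> zeval C D Fo Fa A p \<in> Hom D (Fo A) (Fo B)"
proof (induction rule: zigzag.induct)
  case (Nil A)
  then show ?case by (simp add: cod.Id_in_Hom map_Obj)
next
  case (Fwd f A B p E)
  then show ?case using cod.Comp_in_Hom[OF map_Hom[OF Fwd(1)] Fwd.IH] by (simp add: HomD(3)[OF Fwd(1)])
next
  case (Bwd w B A p E)
  then show ?case using cod.Comp_in_Hom[OF The_inverse_Hom[OF inv[OF Bwd(1)] Bwd(2)] Bwd.IH]
    by (simp add: HomD(2)[OF Bwd(2)])
qed

lemma zeval_append:
  assumes inv: "\<And>w. w \<in> W \<Longrightarrow> isomorphism D (Fa w)"
  shows "zigzag C W A p B \<Longrightarrow> zigzag C W B q E \<Longrightarrow>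
    zeval C D Fo Fa A (p @ q) = Comp D (zeval C D Fo Fa B q) (zeval C D Fo Fa A p)"
proof (induction rule: zigzag.induct)
  case (Nil A)
  then show ?case using zeval_Hom[OF inv Nil(2)] by (simp add: cod.Comp_Id_right)
next
  case (Fwd f A B' p B)
  show ?case
    using Fwd.IH[OF Fwd.prems] cod.Comp_assoc[OF map_Hom[OF Fwd(1)] zeval_Hom[OF inv Fwd(2)]
        zeval_Hom[OF inv Fwd.prems]]
    by (simp add: HomD(3)[OF Fwd(1)])
next
  case (Bwd w B' A p B)
  show ?case
    using Bwd.IH[OF Bwd.prems] cod.Comp_assoc[OF The_inverse_Hom[OF inv[OF Bwd(1)] Bwd(2)]
        zeval_Hom[OF inv Bwd(3)] zeval_Hom[OF inv Bwd.prems]]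
    by (simp add: HomD(2)[OF Bwd(2)])
qed

lemma zeval_zeq:
  assumes inv: "\<And>w. w \<in> W \<Longrightarrow> isomorphism D (Fa w)"
  shows "zeq C W A B p q \<Longrightarrow> zeval C D Fo Fa A p = zeval C D Fo Fa A q"
proof (induction rule: zeq.induct)
  case (id A)
  then show ?case
    using dom.Id_in_Hom[OF id] cod.Comp_Id_left[OF cod.Id_in_Hom[OF map_Obj[OF id]]]
    by (simp add: map_Id HomD(3))
next
  case (comp f A B g E)
  note h = dom.Comp_in_Hom[OF comp]
  have "Comp D (Id D (Fo E)) (Fa g) = Fa g"
    using map_Hom[OF comp(2)] by (rule cod.Comp_Id_left)
  moreover have "Comp D (Id D (Fo E)) (Fa (Comp C g f)) = Fa (Comp C g f)"
    using map_Hom[OF h] by (rule cod.Comp_Id_left)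
  ultimately show ?case using map_Comp[OF comp]
    by (simp add: HomD(3)[OF comp(2)] HomD(3)[OF h])
next
  case (inv_right w A B)
  note v = The_inverse[OF inv[OF inv_right(1)]] and F = map_Hom[OF inv_right(2)]
  show ?case
    using inverse_arrows_Hom[OF v F] cod.Comp_Id_left
    by (simp add: HomD[OF inv_right(2)])
next
  case (inv_left w A B)
  note v = The_inverse[OF inv[OF inv_left(1)]] and F = map_Hom[OF inv_left(2)]
  show ?case
    using inverse_arrows_Hom[OF v F] cod.Comp_Id_left[OF F]
    by (simp add: HomD[OF inv_left(2)])
next
  case (cong A B p p' E q q')
  have "zigzag C W A p B" "zigzag C W A p' B" "zigzag C W B q E" "zigzag C W B q' E"
    using dom.zeq_zigzag cong(1,2) by blast+
  then show ?case using cong(3,4) by (simp add: zeval_append[OF inv])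
qed simp_all

text \<open>Universal property of the localization.\<close>

theorem Ho_extension_exists:
  assumes inv: "\<And>w. w \<in> W \<Longrightarrow> isomorphism D (Fa w)"
  shows "\<exists>Go Ga. cat_functor (Ho C W) D Go Ga \<and>
    (\<forall>A\<in>Obj C. Go A = Fo A) \<and> (\<forall>f\<in>Arr C. Ga (loc C W f) = Fa f)"
proof -
  define Ga where "Ga = (\<lambda>(A, P, B :: 'o). zeval C D Fo Fa A (SOME p. p \<in> P))"
  have Ga: "Ga (zclass C W A B p) = zeval C D Fo Fa A p" if "zigzag C W A p B" for A B p
  proof -
    have "zeq C W A B p (SOME q. zeq C W A B p q)"
      using zeq.refl[OF that] by (rule someI)
    then show ?thesis using zeval_zeq[OF inv] by (simp add: Ga_def zclass_def)
  qed
  have "cat_functor (Ho C W) D Fo Ga"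
  proof (intro cat_functor.intro dom.Ho_category cat_functor_axioms.intro)
    show "category D" ..
  next
    fix A assume "A \<in> Obj (Ho C W)"
    then have A: "A \<in> Obj C" by (simp add: Ho_def)
    then show "Fo A \<in> Obj D" by (rule map_Obj)
    show "Ga (Id (Ho C W) A) = Id D (Fo A)"
      using Ga[OF zigzag.Nil[OF A]] by (simp add: Ho_def)
  next
    fix x A B assume x: "x \<in> Hom (Ho C W) A B"
    then show "Ga x \<in> Hom D (Fo A) (Fo B)"
      using Ga zeval_Hom[OF inv] by (auto elim!: dom.Ho_HomE)
    fix y E assume "y \<in> Hom (Ho C W) B E"
    with x show "Ga (Comp (Ho C W) y x) = Comp D (Ga y) (Ga x)"
      by (elim dom.Ho_HomE)
        (simp add: dom.zclass_Comp Ga dom.zigzag_append zeval_append[OF inv])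
  qed
  moreover have "Ga (loc C W f) = Fa f" if "f \<in> Arr C" for f
  proof -
    have f: "f \<in> Hom C (Dom C f) (Cod C f)" using that by (simp add: Hom_def)
    show ?thesis
      using Ga[OF dom.zigzag_single(1)[OF f]] cod.Comp_Id_left[OF map_Hom[OF f]]
      by (simp add: loc_def)
  qed
  ultimately show ?thesis by blast
qed

end

theorem (in weq_category) Ho_extension_unique:
  assumes G: "cat_functor (Ho C W) D Go Ga" and K: "cat_functor (Ho C W) D Ko Ka"
    and obj: "\<And>A. A \<in> Obj C \<Longrightarrow> Go A = Ko A"
    and arr: "\<And>f. f \<in> Arr C \<Longrightarrow> Ga (loc C W f) = Ka (loc C W f)"
    and x: "x \<in> Arr (Ho C W)"
  shows "Ga x = Ka x"
proof -
  interpret G: cat_functor "Ho C W" D Go Ga by (rule G)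
  interpret K: cat_functor "Ho C W" D Ko Ka by (rule K)
  have agree_Bwd: "Ga (zclass C W B A [Bwd w]) = Ka (zclass C W B A [Bwd w])"
    if w: "w \<in> W" "w \<in> Hom C A B" for w A B
  proof -
    have AB: "A \<in> Obj (Ho C W)" "B \<in> Obj (Ho C W)"
      using Hom_Obj[OF w(2)] by (simp_all add: Ho_def)
    have lw: "loc C W w \<in> Hom (Ho C W) A B"
      using zclass_Hom zigzag_single(1) loc_Hom_eq w(2) by metis
    note I = inverse_arrows_Hom[OF loc_inverse[OF w] lw]
    have "inverse_arrows D (Ga (loc C W w)) (Ga (zclass C W B A [Bwd w]))"
      unfolding inverse_arrows_def
      using G.map_Hom[OF lw] G.map_Hom[OF I(1)] G.map_Comp[OF lw I(1)] G.map_Comp[OF I(1) lw]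
        I(2,3) G.map_Id AB by metis
    moreover have "inverse_arrows D (Ka (loc C W w)) (Ka (zclass C W B A [Bwd w]))"
      unfolding inverse_arrows_def
      using K.map_Hom[OF lw] K.map_Hom[OF I(1)] K.map_Comp[OF lw I(1)] K.map_Comp[OF I(1) lw]
        I(2,3) K.map_Id AB by metis
    moreover have "Ga (loc C W w) = Ka (loc C W w)" using arr HomD(1)[OF w(2)] .
    ultimately show ?thesis using G.cod.inverse_arrows_unique by metis
  qed
  have "Ga (zclass C W A B p) = Ka (zclass C W A B p)" if "zigzag C W A p B" for A B p
    using that
  proof (induction rule: zigzag.induct)
    case (Nil A)
    then show ?case using G.map_Id K.map_Id obj by (simp add: Ho_def)
  next
    case (Fwd f A B p E)
    note z = zigzag_single(1)[OF Fwd(1)]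
    have "Ga (zclass C W A B [Fwd f]) = Ka (zclass C W A B [Fwd f])"
      using arr[OF HomD(1)[OF Fwd(1)]] loc_Hom_eq[OF Fwd(1)] by simp
    then show ?case
      using Fwd.IH zclass_Comp[OF z Fwd(2)] G.map_Comp[OF zclass_Hom[OF z] zclass_Hom[OF Fwd(2)]]
        K.map_Comp[OF zclass_Hom[OF z] zclass_Hom[OF Fwd(2)]] by simp
  next
    case (Bwd w B A p E)
    note z = zigzag_single(2)[where W=W, OF Bwd(1,2)]
    show ?case
      using Bwd.IH agree_Bwd[OF Bwd(1,2)]
        zclass_Comp[OF z Bwd(3)] G.map_Comp[OF zclass_Hom[OF z] zclass_Hom[OF Bwd(3)]]
        K.map_Comp[OF zclass_Hom[OF z] zclass_Hom[OF Bwd(3)]] by simp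
  qed
  moreover obtain A B p where "x = zclass C W A B p" "zigzag C W A p B"
    using x by (auto simp: Ho_def)
  ultimately show ?thesis by simp
qed


section \<open>Homotopy relations\<close>

definition homotopy_rel :: "('o, 'a) cat \<Rightarrow> 'a set \<Rightarrow> 'a \<Rightarrow> 'a \<Rightarrow> bool" where
  "homotopy_rel C W f g \<longleftrightarrow>
    (\<exists>A B. f \<in> Hom C A B \<and> g \<in> Hom C A B) \<and> loc C W f = loc C W g"

text \<open>In the relations \<open>R\<^sub>l\<^sup>c\<close> and \<open>R\<^sub>r\<^sup>c\<close> only \<open>\<sigma>\<close>, respectively \<open>s\<close>, is required to be
  a weak equivalence.\<close>

definition left_rel :: "('o, 'a) cat \<Rightarrow> 'a set \<Rightarrow> 'a \<Rightarrow> 'a \<Rightarrow> bool" where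
  "left_rel C W f g \<longleftrightarrow>
    (\<exists>A B X A' \<alpha> \<delta>0 \<delta>1 \<sigma> h.
      f \<in> Hom C A B \<and> g \<in> Hom C A B \<and>
      \<alpha> \<in> Hom C A X \<and> \<delta>0 \<in> Hom C A A' \<and> \<delta>1 \<in> Hom C A A' \<and>
      \<sigma> \<in> Hom C A' X \<and> h \<in> Hom C A' B \<and> \<sigma> \<in> W \<and>
      Comp C \<sigma> \<delta>0 = \<alpha> \<and> Comp C \<sigma> \<delta>1 = \<alpha> \<and> Comp C h \<delta>0 = f \<and> Comp C h \<delta>1 = g)"

definition right_rel :: "('o, 'a) cat \<Rightarrow> 'a set \<Rightarrow> 'a \<Rightarrow> 'a \<Rightarrow> bool" where
  "right_rel C W f g \<longleftrightarrow>
    (\<exists>A B X B' \<beta> d0 d1 s k.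
      f \<in> Hom C A B \<and> g \<in> Hom C A B \<and>
      \<beta> \<in> Hom C X B \<and> d0 \<in> Hom C B' B \<and> d1 \<in> Hom C B' B \<and>
      s \<in> Hom C X B' \<and> k \<in> Hom C A B' \<and> s \<in> W \<and>
      Comp C d0 s = \<beta> \<and> Comp C d1 s = \<beta> \<and> Comp C d0 k = f \<and> Comp C d1 k = g)"

text \<open>Forks are listed with their vertex \<open>A\<close> (resp. \<open>B\<close>) and middle object \<open>A'\<close> (resp. \<open>B'\<close>).\<close>

definition left_fork ::
  "('o, 'a) cat \<Rightarrow> 'a set \<Rightarrow> 'o \<Rightarrow> 'o \<Rightarrow> 'a \<Rightarrow> 'a \<Rightarrow> 'a \<Rightarrow> 'a \<Rightarrow> bool" where
  "left_fork C W A A' \<alpha> \<delta>0 \<delta>1 \<sigma> \<longleftrightarrow>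
    (\<exists>X. \<alpha> \<in> Hom C A X \<and> \<delta>0 \<in> Hom C A A' \<and> \<delta>1 \<in> Hom C A A' \<and> \<sigma> \<in> Hom C A' X \<and>
      Comp C \<sigma> \<delta>0 = \<alpha> \<and> Comp C \<sigma> \<delta>1 = \<alpha> \<and> \<sigma> \<in> W \<and> \<alpha> \<in> W)"

definition left_homotopy ::
  "('o, 'a) cat \<Rightarrow> 'o \<Rightarrow> 'o \<Rightarrow> 'a \<Rightarrow> 'a \<Rightarrow> 'a \<Rightarrow> 'a \<Rightarrow> 'a \<Rightarrow> bool" where
  "left_homotopy C A' B \<delta>0 \<delta>1 f g h \<longleftrightarrow>
    h \<in> Hom C A' B \<and> Comp C h \<delta>0 = f \<and> Comp C h \<delta>1 = g"

definition right_fork ::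
  "('o, 'a) cat \<Rightarrow> 'a set \<Rightarrow> 'o \<Rightarrow> 'o \<Rightarrow> 'a \<Rightarrow> 'a \<Rightarrow> 'a \<Rightarrow> 'a \<Rightarrow> bool" where
  "right_fork C W B B' \<beta> d0 d1 s \<longleftrightarrow>
    (\<exists>X. \<beta> \<in> Hom C X B \<and> d0 \<in> Hom C B' B \<and> d1 \<in> Hom C B' B \<and> s \<in> Hom C X B' \<and>
      Comp C d0 s = \<beta> \<and> Comp C d1 s = \<beta> \<and> s \<in> W \<and> \<beta> \<in> W)"

definition right_homotopy ::
  "('o, 'a) cat \<Rightarrow> 'o \<Rightarrow> 'o \<Rightarrow> 'a \<Rightarrow> 'a \<Rightarrow> 'a \<Rightarrow> 'a \<Rightarrow> 'a \<Rightarrow> bool" where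
  "right_homotopy C A B' d0 d1 f g k \<longleftrightarrow>
    k \<in> Hom C A B' \<and> Comp C d0 k = f \<and> Comp C d1 k = g"

definition common_fork :: "('o, 'a) cat \<Rightarrow> 'a set \<Rightarrow> bool" where
  "common_fork C W \<longleftrightarrow>
    (\<forall>A B. \<forall>f\<in>Hom C A B. \<forall>g\<in>Hom C A B. \<forall>f'\<in>Hom C A B. \<forall>g'\<in>Hom C A B.
      (left_rel C W f g \<and> left_rel C W f' g' \<longrightarrow>
        (\<exists>A' \<alpha> \<delta>0 \<delta>1 \<sigma>. left_fork C W A A' \<alpha> \<delta>0 \<delta>1 \<sigma> \<and>
          (\<exists>h. left_homotopy C A' B \<delta>0 \<delta>1 f g h) \<and>
          (\<exists>h. left_homotopy C A' B \<delta>0 \<delta>1 f' g' h))) \<and>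
      (right_rel C W f g \<and> right_rel C W f' g' \<longrightarrow>
        (\<exists>B' \<beta> d0 d1 s. right_fork C W B B' \<beta> d0 d1 s \<and>
          (\<exists>k. right_homotopy C A B' d0 d1 f g k) \<and>
          (\<exists>k. right_homotopy C A B' d0 d1 f' g' k))))"

end

theory Submission
  imports Defs
begin

text \<open>
  Let \<open>R\<^sub>l\<close> and \<open>R\<^sub>r\<close> stand for \<open>left_rel\<close> and \<open>right_rel\<close>.  Both are reflexive, symmetric and stable
  under composition on either side for formal reasons; the only nontrivial points are their
  transitivity and their equality, and both come from one observation.

  Suppose that two left homotopies \<open>h : g \<leadsto> f\<close> and \<open>h' : g \<leadsto> k\<close> live on the same left fork of weak
  equivalences \<open>(\<alpha>, \<delta>0, \<delta>1, \<sigma>)\<close>.  Then \<open>\<delta>0\<close> is a weak equivalence by two out of three, and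
  \<open>h \<delta>0 = g = h' \<delta>0\<close>.  So \<open>h\<close> and \<open>h'\<close>, read as the two legs of a right cylinder with \<open>\<delta>0\<close> as the
  common section, show through \<open>\<delta>1\<close> that \<open>f R\<^sub>r k\<close>.  Taking \<open>k = g\<close> gives \<open>R\<^sub>l \<subseteq> R\<^sub>r\<close>; the dual
  argument gives \<open>R\<^sub>r \<subseteq> R\<^sub>l\<close>; and then the general case is the transitivity of \<open>R\<^sub>l\<close>.

  Hence \<open>R\<^sub>l\<close> is a congruence.  In the quotient of the category by it, a weak equivalence that
  splits becomes invertible: if \<open>r w = 1\<close> with \<open>r, w\<close> weak equivalences, then \<open>r (w r) = r = r 1\<close>, so
  \<open>w r R\<^sub>l 1\<close>.  As the weak equivalences are composites of such arrows, the quotient functor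
  inverts all of them and factors through the localization; therefore arrows that become equal
  there are already congruent.  The converse holds since a weak equivalence can be
  cancelled in the localization.\<close>

section \<open>Isomorphisms\<close>

context category
begin

lemma isomorphism_Comp:
  assumes f: "f \<in> Hom C A B" "isomorphism C f" and g: "g \<in> Hom C B D" "isomorphism C g"
  shows "isomorphism C (g \<cdot> f)"
proof -
  obtain f' g' where "inverse_arrows C f f'" "inverse_arrows C g g'"
    using f g by (auto simp: isomorphism_def)
  note F = inverse_arrows_Hom[OF this(1) f(1)] and G = inverse_arrows_Hom[OF this(2) g(1)]
  note gf = Comp_in_Hom[OF f(1) g(1)] and fg' = Comp_in_Hom[OF G(1) F(1)]
  have "(f' \<cdot> g') \<cdot> (g \<cdot> f) = f' \<cdot> ((g' \<cdot> g) \<cdot> f)"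
    using Comp_assoc[OF gf G(1) F(1)] Comp_assoc[OF f(1) g(1) G(1)] by simp
  then have 1: "(f' \<cdot> g') \<cdot> (g \<cdot> f) = Id C A" using F G Comp_Id_left[OF f(1)] by simp
  have "(g \<cdot> f) \<cdot> (f' \<cdot> g') = g \<cdot> ((f \<cdot> f') \<cdot> g')"
    using Comp_assoc[OF fg' f(1) g(1)] Comp_assoc[OF G(1) F(1) f(1)] by simp
  then have 2: "(g \<cdot> f) \<cdot> (f' \<cdot> g') = Id C D" using F G Comp_Id_left[OF G(1)] by simp
  show ?thesis unfolding isomorphism_def inverse_arrows_def using gf fg' 1 2 by blast
qed

lemma isomorphism_monic:
  assumes w: "w \<in> Hom C B D" "isomorphism C w"
    and f: "f \<in> Hom C A B" and g: "g \<in> Hom C A B" and eq: "w \<cdot> f = w \<cdot> g"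
  shows "f = g"
proof -
  obtain v where "inverse_arrows C w v" using w(2) by (auto simp: isomorphism_def)
  note V = inverse_arrows_Hom[OF this w(1)]
  have "f = v \<cdot> (w \<cdot> f)" using Comp_assoc[OF f w(1) V(1)] V(2) Comp_Id_left[OF f] by simp
  also have "\<dots> = g" using eq Comp_assoc[OF g w(1) V(1)] V(2) Comp_Id_left[OF g] by simp
  finally show ?thesis .
qed

end

section \<open>The quotient of a category by a congruence\<close>

locale category_congruence = category C for C :: "('o, 'a) cat" (structure) +
  fixes R :: "'a \<Rightarrow> 'a \<Rightarrow> bool"
  assumes R_parallel: "R f g \<Longrightarrow> \<exists>A B. f \<in> Hom C A B \<and> g \<in> Hom C A B"
    and R_refl: "f \<in> Arr C \<Longrightarrow> R f f"
    and R_sym: "R f g \<Longrightarrow> R g f"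
    and R_trans: "R f g \<Longrightarrow> R g h \<Longrightarrow> R f h"
    and R_postcomp: "R f g \<Longrightarrow> f \<in> Hom C A B \<Longrightarrow> u \<in> Hom C B D \<Longrightarrow> R (u \<cdot> f) (u \<cdot> g)"
    and R_precomp: "R f g \<Longrightarrow> f \<in> Hom C A B \<Longrightarrow> u \<in> Hom C D A \<Longrightarrow> R (f \<cdot> u) (g \<cdot> u)"
begin

definition cls :: "'a \<Rightarrow> 'a set" where
  "cls f = {g. R f g}"

text \<open>Congruent arrows are parallel, so any representative of a class gives its domain and
  codomain.\<close>

definition quotient :: "('o, 'a set) cat" where
  "quotient = \<lparr>
    Obj = Obj C,
    Arr = cls ` Arr C,
    Dom = (\<lambda>P. Dom C (SOME f. f \<in> P)),
    Cod = (\<lambda>P. Cod C (SOME f. f \<in> P)),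
    Id = (\<lambda>A. cls (Id C A)),
    Comp = (\<lambda>Q P. {h. \<exists>f\<in>P. \<exists>g\<in>Q. R (g \<cdot> f) h})\<rparr>"

lemma R_Hom: "R f g \<Longrightarrow> f \<in> Hom C A B \<Longrightarrow> g \<in> Hom C A B"
  using R_parallel by (fastforce simp: Hom_def)

lemma cls_eq: "f \<in> Arr C \<Longrightarrow> cls f = cls g \<longleftrightarrow> R f g"
  unfolding cls_def using R_refl R_sym R_trans by blast

lemma cls_Dom_Cod:
  assumes "f \<in> Hom C A B"
  shows "Dom quotient (cls f) = A" "Cod quotient (cls f) = B"
proof -
  have "R f (SOME g. g \<in> cls f)"
    using R_refl[OF HomD(1)[OF assms]] by (simp add: cls_def) (rule someI)
  then have "(SOME g. g \<in> cls f) \<in> Hom C A B" using assms by (rule R_Hom)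
  then show "Dom quotient (cls f) = A" "Cod quotient (cls f) = B"
    by (simp_all add: quotient_def Hom_def)
qed

lemma cls_Hom: "f \<in> Hom C A B \<Longrightarrow> cls f \<in> Hom quotient A B"
  using cls_Dom_Cod[of f A B] HomD(1)[of f C A B]
  by (simp add: Hom_def[of quotient]) (simp add: quotient_def)

lemma quotient_HomE:
  assumes "x \<in> Hom quotient A B"
  obtains f where "x = cls f" "f \<in> Hom C A B"
proof -
  obtain f where f: "x = cls f" "f \<in> Arr C"
    using HomD(1)[OF assms] by (auto simp: quotient_def)
  then have "f \<in> Hom C (Dom C f) (Cod C f)" by (simp add: Hom_def)
  with f cls_Dom_Cod[OF this] HomD[OF assms] show ?thesis by (auto intro: that)
qed

lemma cls_Comp:
  assumes f: "f \<in> Hom C A B" and g: "g \<in> Hom C B D"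
  shows "Comp quotient (cls g) (cls f) = cls (g \<cdot> f)"
proof -
  have "R (g \<cdot> f) (g' \<cdot> f')" if "R f f'" "R g g'" for f' g'
    using R_trans[OF R_postcomp[OF that(1) f g] R_precomp[OF that(2) g R_Hom[OF that(1) f]]] .
  then have "(\<exists>f'. R f f' \<and> (\<exists>g'. R g g' \<and> R (g' \<cdot> f') h)) \<longleftrightarrow> R (g \<cdot> f) h" for h
    using R_refl[OF HomD(1)[OF f]] R_refl[OF HomD(1)[OF g]] R_trans by blast
  then show ?thesis by (simp add: quotient_def cls_def)
qed

lemma quotient_Id: "Id quotient A = cls (Id C A)"
  by (simp add: quotient_def)

lemma quotient_category: "category quotient"
proof
  fix x assume "x \<in> Arr quotient"
  then have "x \<in> Hom quotient (Dom quotient x) (Cod quotient x)" by (simp add: Hom_def)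
  then obtain f where "f \<in> Hom C (Dom quotient x) (Cod quotient x)" by (rule quotient_HomE)
  then show "Dom quotient x \<in> Obj quotient" "Cod quotient x \<in> Obj quotient"
    using Hom_Obj by (auto simp: quotient_def)
next
  fix A assume "A \<in> Obj quotient"
  then show "Id quotient A \<in> Hom quotient A A"
    unfolding quotient_Id using cls_Hom Id_in_Hom by (simp add: quotient_def)
next
  fix x A B y D assume "x \<in> Hom quotient A B" "y \<in> Hom quotient B D"
  then show "Comp quotient y x \<in> Hom quotient A D"
    by (elim quotient_HomE) (simp add: cls_Comp cls_Hom Comp_in_Hom)
next
  fix x A B assume "x \<in> Hom quotient A B"
  then obtain f where f: "x = cls f" "f \<in> Hom C A B" by (rule quotient_HomE)
  note I = Hom_Obj[OF f(2), THEN Id_in_Hom]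
  show "Comp quotient x (Id quotient A) = x" "Comp quotient (Id quotient B) x = x"
    using f cls_Comp[OF I(1) f(2)] cls_Comp[OF f(2) I(2)]
    by (simp_all add: quotient_Id Comp_Id_left Comp_Id_right)
next
  fix x A B y D z E
  assume x: "x \<in> Hom quotient A B" and y: "y \<in> Hom quotient B D" and z: "z \<in> Hom quotient D E"
  obtain f where f: "x = cls f" "f \<in> Hom C A B" using x by (rule quotient_HomE)
  obtain g where g: "y = cls g" "g \<in> Hom C B D" using y by (rule quotient_HomE)
  obtain h where h: "z = cls h" "h \<in> Hom C D E" using z by (rule quotient_HomE)
  show "Comp quotient (Comp quotient z y) x = Comp quotient z (Comp quotient y x)"
    using cls_Comp[OF f(2) g(2)] cls_Comp[OF g(2) h(2)] cls_Comp[OF f(2) Comp_in_Hom[OF g(2) h(2)]]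
      cls_Comp[OF Comp_in_Hom[OF f(2) g(2)] h(2)] Comp_assoc[OF f(2) g(2) h(2)]
    by (simp add: f(1) g(1) h(1))
qed

theorem quotient_functor: "cat_functor C quotient (\<lambda>A. A) cls"
proof (intro cat_functor.intro quotient_category cat_functor_axioms.intro)
  show "category C" ..
qed (simp_all add: cls_Hom cls_Comp quotient_Id, simp add: quotient_def)

text \<open>The universal property of the localization, applied to the quotient functor.\<close>

lemma loc_eq_imp_R:
  assumes inv: "\<And>w. w \<in> W \<Longrightarrow> isomorphism quotient (cls w)"
    and f: "f \<in> Arr C" and g: "g \<in> Arr C" and eq: "loc C W f = loc C W g"
  shows "R f g"
proof -
  interpret Q: cat_functor C quotient "\<lambda>A. A" cls by (rule quotient_functor)
  obtain Ga where "\<And>u. u \<in> Arr C \<Longrightarrow> Ga (loc C W u) = cls u"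
    using Q.Ho_extension_exists[of W, OF inv] by blast
  then have "cls f = cls g" using f g eq by metis
  then show ?thesis using cls_eq[OF f] by simp
qed

end

section \<open>Cylinder relations in a category with weak equivalences\<close>

lemma left_relI:
  assumes "\<delta>0 \<in> Hom C A A'" "\<delta>1 \<in> Hom C A A'" "\<sigma> \<in> Hom C A' X" "\<sigma> \<in> W" "h \<in> Hom C A' B"
    "Comp C \<sigma> \<delta>0 = Comp C \<sigma> \<delta>1" "category C"
  shows "left_rel C W (Comp C h \<delta>0) (Comp C h \<delta>1)"
  unfolding left_rel_def
  by (rule exI[of _ A], rule exI[of _ B], rule exI[of _ X], rule exI[of _ A'],
      rule exI[of _ "Comp C \<sigma> \<delta>1"], rule exI[of _ \<delta>0], rule exI[of _ \<delta>1],
      rule exI[of _ \<sigma>], rule exI[of _ h])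
    (simp add: assms category.Comp_in_Hom[OF assms(7) assms(1) assms(5)]
      category.Comp_in_Hom[OF assms(7) assms(2) assms(5)]
      category.Comp_in_Hom[OF assms(7) assms(2) assms(3)])

lemma right_relI:
  assumes "d0 \<in> Hom C B' B" "d1 \<in> Hom C B' B" "s \<in> Hom C X B'" "s \<in> W" "k \<in> Hom C A B'"
    "Comp C d0 s = Comp C d1 s" "category C"
  shows "right_rel C W (Comp C d0 k) (Comp C d1 k)"
  unfolding right_rel_def
  by (rule exI[of _ A], rule exI[of _ B], rule exI[of _ X], rule exI[of _ B'],
      rule exI[of _ "Comp C d1 s"], rule exI[of _ d0], rule exI[of _ d1],
      rule exI[of _ s], rule exI[of _ k])
    (simp add: assms category.Comp_in_Hom[OF assms(7) assms(5) assms(1)]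
      category.Comp_in_Hom[OF assms(7) assms(5) assms(2)]
      category.Comp_in_Hom[OF assms(7) assms(3) assms(2)])

lemma left_relE:
  assumes "left_rel C W f g"
  obtains A B A' X \<delta>0 \<delta>1 \<sigma> h where "f \<in> Hom C A B" "g \<in> Hom C A B"
    "\<delta>0 \<in> Hom C A A'" "\<delta>1 \<in> Hom C A A'" "\<sigma> \<in> Hom C A' X" "\<sigma> \<in> W" "h \<in> Hom C A' B"
    "Comp C \<sigma> \<delta>0 = Comp C \<sigma> \<delta>1" "f = Comp C h \<delta>0" "g = Comp C h \<delta>1"
proof -
  from assms obtain A B X A' \<alpha> \<delta>0 \<delta>1 \<sigma> h where
    "f \<in> Hom C A B \<and> g \<in> Hom C A B \<and>
      \<alpha> \<in> Hom C A X \<and> \<delta>0 \<in> Hom C A A' \<and> \<delta>1 \<in> Hom C A A' \<and>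
      \<sigma> \<in> Hom C A' X \<and> h \<in> Hom C A' B \<and> \<sigma> \<in> W \<and>
      Comp C \<sigma> \<delta>0 = \<alpha> \<and> Comp C \<sigma> \<delta>1 = \<alpha> \<and> Comp C h \<delta>0 = f \<and> Comp C h \<delta>1 = g"
    unfolding left_rel_def by (elim exE) (rule that)
  then show thesis by (intro that[of A B \<delta>0 A' \<delta>1 \<sigma> X h]) simp_all
qed

lemma right_relE:
  assumes "right_rel C W f g"
  obtains A B B' X d0 d1 s k where "f \<in> Hom C A B" "g \<in> Hom C A B"
    "d0 \<in> Hom C B' B" "d1 \<in> Hom C B' B" "s \<in> Hom C X B'" "s \<in> W" "k \<in> Hom C A B'"
    "Comp C d0 s = Comp C d1 s" "f = Comp C d0 k" "g = Comp C d1 k"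
proof -
  from assms obtain A B X B' \<beta> d0 d1 s k where
    "f \<in> Hom C A B \<and> g \<in> Hom C A B \<and>
      \<beta> \<in> Hom C X B \<and> d0 \<in> Hom C B' B \<and> d1 \<in> Hom C B' B \<and>
      s \<in> Hom C X B' \<and> k \<in> Hom C A B' \<and> s \<in> W \<and>
      Comp C d0 s = \<beta> \<and> Comp C d1 s = \<beta> \<and> Comp C d0 k = f \<and> Comp C d1 k = g"
    unfolding right_rel_def by (elim exE) (rule that)
  then show thesis by (intro that[of A B d0 B' d1 s X k]) simp_all
qed

context weq_category
begin

lemma left_rel_Hom: "left_rel C W f g \<Longrightarrow> f \<in> Hom C A B \<Longrightarrow> g \<in> Hom C A B"
  by (erule left_relE) (simp add: Hom_def)

lemma right_rel_Hom: "right_rel C W f g \<Longrightarrow> f \<in> Hom C A B \<Longrightarrow> g \<in> Hom C A B"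
  by (erule right_relE) (simp add: Hom_def)

lemma left_rel_sym:
  assumes "left_rel C W f g" shows "left_rel C W g f"
proof -
  obtain A B A' X \<delta>0 \<delta>1 \<sigma> h where "\<delta>0 \<in> Hom C A A'" "\<delta>1 \<in> Hom C A A'" "\<sigma> \<in> Hom C A' X" "\<sigma> \<in> W"
    "h \<in> Hom C A' B" "\<sigma> \<cdot> \<delta>0 = \<sigma> \<cdot> \<delta>1" "f = h \<cdot> \<delta>0" "g = h \<cdot> \<delta>1"
    using assms by (rule left_relE)
  then show ?thesis using left_relI[of \<delta>1 C A A' \<delta>0 \<sigma> X W h B] category_axioms by simp
qed

lemma right_rel_sym:
  assumes "right_rel C W f g" shows "right_rel C W g f"
proof -
  obtain A B B' X d0 d1 s k where "d0 \<in> Hom C B' B" "d1 \<in> Hom C B' B" "s \<in> Hom C X B'" "s \<in> W"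
    "k \<in> Hom C A B'" "d0 \<cdot> s = d1 \<cdot> s" "f = d0 \<cdot> k" "g = d1 \<cdot> k"
    using assms by (rule right_relE)
  then show ?thesis using right_relI[of d1 C B' B d0 s X W k A] category_axioms by simp
qed

lemma left_rel_refl:
  assumes "f \<in> Hom C A B" shows "left_rel C W f f"
proof -
  note A = Hom_Obj(1)[OF assms]
  show ?thesis
    using left_relI[OF Id_in_Hom[OF A] Id_in_Hom[OF A] Id_in_Hom[OF A] Id_W[OF A] assms
        HOL.refl category_axioms] Comp_Id_right[OF assms] by simp
qed

lemma right_rel_refl:
  assumes "f \<in> Hom C A B" shows "right_rel C W f f"
proof -
  note B = Hom_Obj(2)[OF assms]
  show ?thesis
    using right_relI[OF Id_in_Hom[OF B] Id_in_Hom[OF B] Id_in_Hom[OF B] Id_W[OF B] assms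
        HOL.refl category_axioms] Comp_Id_left[OF assms] by simp
qed

lemma left_rel_postcomp:
  assumes "left_rel C W f g" "f \<in> Hom C A B" "u \<in> Hom C B D"
  shows "left_rel C W (u \<cdot> f) (u \<cdot> g)"
  using assms(1)
proof (rule left_relE)
  fix E F A' X \<delta>0 \<delta>1 \<sigma> h
  assume f: "f \<in> Hom C E F"
    and c: "\<delta>0 \<in> Hom C E A'" "\<delta>1 \<in> Hom C E A'" "\<sigma> \<in> Hom C A' X" "\<sigma> \<in> W"
    and h: "h \<in> Hom C A' F" and e: "\<sigma> \<cdot> \<delta>0 = \<sigma> \<cdot> \<delta>1" "f = h \<cdot> \<delta>0" "g = h \<cdot> \<delta>1"
  have u: "u \<in> Hom C F D" using f assms(2,3) by (simp add: Hom_def)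
  show ?thesis
    using left_relI[OF c Comp_in_Hom[OF h u] e(1) category_axioms]
    by (simp add: e(2,3) Comp_assoc[OF c(1) h u] Comp_assoc[OF c(2) h u])
qed

text \<open>The cylinder \<open>(\<alpha>, \<delta>0, \<delta>1, \<sigma>)\<close> pulls back to \<open>(\<alpha> u, \<delta>0 u, \<delta>1 u, \<sigma>)\<close>.  Here \<open>\<alpha> u\<close> may fail to
  be a weak equivalence even if \<open>\<alpha>\<close> is one, so forks of weak equivalences are not stable in this way.\<close>

lemma left_rel_precomp:
  assumes "left_rel C W f g" "f \<in> Hom C A B" "u \<in> Hom C D A"
  shows "left_rel C W (f \<cdot> u) (g \<cdot> u)"
  using assms(1)
proof (rule left_relE)
  fix E F A' X \<delta>0 \<delta>1 \<sigma> h
  assume f: "f \<in> Hom C E F"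
    and c: "\<delta>0 \<in> Hom C E A'" "\<delta>1 \<in> Hom C E A'" "\<sigma> \<in> Hom C A' X" "\<sigma> \<in> W"
    and h: "h \<in> Hom C A' F" and e: "\<sigma> \<cdot> \<delta>0 = \<sigma> \<cdot> \<delta>1" "f = h \<cdot> \<delta>0" "g = h \<cdot> \<delta>1"
  have u: "u \<in> Hom C D E" using f assms(2,3) by (simp add: Hom_def)
  have "\<sigma> \<cdot> (\<delta>0 \<cdot> u) = \<sigma> \<cdot> (\<delta>1 \<cdot> u)"
    using Comp_assoc[OF u c(1) c(3)] Comp_assoc[OF u c(2) c(3)] e(1) by simp
  then show ?thesis
    using left_relI[OF Comp_in_Hom[OF u c(1)] Comp_in_Hom[OF u c(2)] c(3,4) h _ category_axioms]
    by (simp add: e(2,3) Comp_assoc[OF u c(1) h] Comp_assoc[OF u c(2) h])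
qed

text \<open>The weak equivalence \<open>\<sigma>\<close> becomes monic in the localization, which identifies \<open>\<delta>0\<close> with \<open>\<delta>1\<close>.\<close>

lemma left_rel_imp_homotopy_rel:
  assumes "left_rel C W f g"
  shows "homotopy_rel C W f g"
  using assms
proof (rule left_relE)
  fix A B A' X \<delta>0 \<delta>1 \<sigma> h
  assume fg: "f \<in> Hom C A B" "g \<in> Hom C A B"
    and d: "\<delta>0 \<in> Hom C A A'" "\<delta>1 \<in> Hom C A A'" and s: "\<sigma> \<in> Hom C A' X" "\<sigma> \<in> W"
    and h: "h \<in> Hom C A' B" and e: "\<sigma> \<cdot> \<delta>0 = \<sigma> \<cdot> \<delta>1" "f = h \<cdot> \<delta>0" "g = h \<cdot> \<delta>1"
  interpret L: cat_functor C "Ho C W" "\<lambda>A. A" "loc C W" by (rule loc_functor)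
  have "loc C W \<delta>0 = loc C W \<delta>1"
    using L.cod.isomorphism_monic[OF L.map_Hom[OF s(1)] loc_inverts[OF s(2)]
        L.map_Hom[OF d(1)] L.map_Hom[OF d(2)]]
      L.map_Comp[OF d(1) s(1)] L.map_Comp[OF d(2) s(1)] e(1) by simp
  then have "loc C W f = loc C W g"
    using L.map_Comp[OF d(1) h] L.map_Comp[OF d(2) h] e by simp
  then show ?thesis using fg by (auto simp: homotopy_rel_def)
qed

text \<open>Since \<open>p (i p) = p = p 1\<close>, the weak equivalence \<open>p\<close> itself serves as the projection \<open>\<sigma>\<close> of a
  cylinder with legs \<open>i p\<close> and \<open>1\<close>, and \<open>h = 1\<close>.\<close>

lemma left_rel_retraction:
  assumes p: "p \<in> Hom C B A" "p \<in> W" and i: "i \<in> Hom C A B" and pi: "p \<cdot> i = Id C A"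
  shows "left_rel C W (i \<cdot> p) (Id C B)"
proof -
  note I = Id_in_Hom[OF Hom_Obj(1)[OF p(1)]] and ip = Comp_in_Hom[OF p(1) i]
  have "p \<cdot> (i \<cdot> p) = p \<cdot> Id C B"
    using Comp_assoc[OF p(1) i p(1)] pi Comp_Id_left[OF p(1)] Comp_Id_right[OF p(1)] by simp
  from left_relI[OF ip I p I this category_axioms] show ?thesis
    using Comp_Id_left[OF ip] Comp_Id_left[OF I] by simp
qed

section \<open>Consequences of the common fork condition\<close>

lemma common_left_fork:
  assumes "common_fork C W" "left_rel C W f g" "left_rel C W f' g'"
    "f \<in> Hom C A B" "f' \<in> Hom C A B"
  obtains A' \<alpha> \<delta>0 \<delta>1 \<sigma> h h' where "left_fork C W A A' \<alpha> \<delta>0 \<delta>1 \<sigma>"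
    "left_homotopy C A' B \<delta>0 \<delta>1 f g h" "left_homotopy C A' B \<delta>0 \<delta>1 f' g' h'"
  using assms(1)[unfolded common_fork_def, rule_format, OF assms(4) left_rel_Hom[OF assms(2,4)]
      assms(5) left_rel_Hom[OF assms(3,5)], THEN conjunct1, THEN mp, OF conjI[OF assms(2,3)]]
  by (elim exE conjE) (rule that)

lemma common_right_fork:
  assumes "common_fork C W" "right_rel C W f g" "right_rel C W f' g'"
    "f \<in> Hom C A B" "f' \<in> Hom C A B"
  obtains B' \<beta> d0 d1 s k k' where "right_fork C W B B' \<beta> d0 d1 s"
    "right_homotopy C A B' d0 d1 f g k" "right_homotopy C A B' d0 d1 f' g' k'"
  using assms(1)[unfolded common_fork_def, rule_format, OF assms(4) right_rel_Hom[OF assms(2,4)]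
      assms(5) right_rel_Hom[OF assms(3,5)], THEN conjunct2, THEN mp, OF conjI[OF assms(2,3)]]
  by (elim exE conjE) (rule that)

text \<open>Two left homotopies out of \<open>g\<close> on one fork agree on the weak equivalence \<open>\<delta>0\<close>, so they are
  themselves the two legs of a right cylinder; its homotopy is \<open>\<delta>1\<close>.\<close>

lemma left_span_imp_right_rel:
  assumes cf: "common_fork C W" and gf: "left_rel C W g f" and gk: "left_rel C W g k"
  shows "right_rel C W f k"
proof -
  obtain A B where g: "g \<in> Hom C A B" using gf by (rule left_relE)
  obtain A' \<alpha> \<delta>0 \<delta>1 \<sigma> h h' where fork: "left_fork C W A A' \<alpha> \<delta>0 \<delta>1 \<sigma>"
    and H: "left_homotopy C A' B \<delta>0 \<delta>1 g f h" "left_homotopy C A' B \<delta>0 \<delta>1 g k h'"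
    by (rule common_left_fork[OF cf gf gk g g])
  have h: "h \<in> Hom C A' B" "h \<cdot> \<delta>0 = g" "h \<cdot> \<delta>1 = f"
    and h': "h' \<in> Hom C A' B" "h' \<cdot> \<delta>0 = g" "h' \<cdot> \<delta>1 = k"
    using H by (simp_all add: left_homotopy_def)
  have d: "\<delta>0 \<in> Hom C A A'" "\<delta>0 \<in> W" "\<delta>1 \<in> Hom C A A'"
    using fork left_cancel_W by (auto simp: left_fork_def)
  show ?thesis using right_relI[OF h(1) h'(1) d _ category_axioms] h h' by simp
qed

lemma right_span_imp_left_rel:
  assumes cf: "common_fork C W" and gf: "right_rel C W g f" and gk: "right_rel C W g k"
  shows "left_rel C W f k"
proof -
  obtain A B where g: "g \<in> Hom C A B" using gf by (rule right_relE)
  obtain B' \<beta> d0 d1 s l l' where fork: "right_fork C W B B' \<beta> d0 d1 s"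
    and H: "right_homotopy C A B' d0 d1 g f l" "right_homotopy C A B' d0 d1 g k l'"
    by (rule common_right_fork[OF cf gf gk g g])
  have l: "l \<in> Hom C A B'" "d0 \<cdot> l = g" "d1 \<cdot> l = f"
    and l': "l' \<in> Hom C A B'" "d0 \<cdot> l' = g" "d1 \<cdot> l' = k"
    using H by (simp_all add: right_homotopy_def)
  have d: "d0 \<in> Hom C B' B" "d0 \<in> W" "d1 \<in> Hom C B' B"
    using fork right_cancel_W by (auto simp: right_fork_def)
  show ?thesis using left_relI[OF l(1) l'(1) d _ category_axioms] l l' by simp
qed

lemma left_rel_eq_right_rel:
  assumes cf: "common_fork C W"
  shows "left_rel C W = right_rel C W"
proof (intro ext iffI)
  fix f g assume fg: "left_rel C W f g"
  then obtain A B where "f \<in> Hom C A B" by (rule left_relE)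
  from left_span_imp_right_rel[OF cf left_rel_refl[OF this] fg] show "right_rel C W f g" .
next
  fix f g assume fg: "right_rel C W f g"
  then obtain A B where "f \<in> Hom C A B" by (rule right_relE)
  from right_span_imp_left_rel[OF cf right_rel_refl[OF this] fg] show "left_rel C W f g" .
qed

lemma left_rel_congruence:
  assumes cf: "common_fork C W"
  shows "category_congruence C (left_rel C W)"
proof
  show "left_rel C W f f" if "f \<in> Arr C" for f
    using left_rel_refl that by (auto simp: Hom_def)
  show "left_rel C W f k" if "left_rel C W f g" "left_rel C W g k" for f g k
    using left_span_imp_right_rel[OF cf left_rel_sym[OF that(1)] that(2)]
    by (simp add: left_rel_eq_right_rel[OF cf])
  show "\<exists>A B. f \<in> Hom C A B \<and> g \<in> Hom C A B" if "left_rel C W f g" for f g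
    using that by (rule left_relE) blast
qed (fact left_rel_sym left_rel_postcomp left_rel_precomp)+

section \<open>Weak equivalences in the quotient\<close>

text \<open>Two out of three makes the one-sided inverse of a split weak equivalence a weak equivalence,
  so whichever of the two arrows is the retraction can serve as the projection of a cylinder.\<close>

lemma splits_isomorphism_quotient:
  assumes cong: "category_congruence C (left_rel C W)" and w: "w \<in> W" "splits C w"
  shows "isomorphism (category_congruence.quotient C (left_rel C W))
    (category_congruence.cls (left_rel C W) w)"
proof -
  interpret Q: category_congruence C "left_rel C W" by (rule cong)
  have "\<exists>A B v. w \<in> Hom C A B \<and> v \<in> Hom C B A \<and>
    left_rel C W (v \<cdot> w) (Id C A) \<and> left_rel C W (w \<cdot> v) (Id C B)"
    using w(2) unfolding splits_def
  proof
    assume "is_section C w"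
    then obtain A B r where h: "w \<in> Hom C A B" "r \<in> Hom C B A" and e: "r \<cdot> w = Id C A"
      unfolding is_section_def by blast
    note I = Hom_Obj(1)[OF h(1)]
    have "r \<in> W" using right_cancel_W[OF h w(1)] Id_W[OF I] e by simp
    from left_rel_retraction[OF h(2) this h(1) e] show ?thesis
      using h e left_rel_refl[OF Id_in_Hom[OF I]] by metis
  next
    assume "is_retraction C w"
    then obtain A B s where h: "w \<in> Hom C A B" "s \<in> Hom C B A" and e: "w \<cdot> s = Id C B"
      unfolding is_retraction_def by blast
    from left_rel_retraction[OF h(1) w(1) h(2) e] show ?thesis
      using h e left_rel_refl[OF Id_in_Hom[OF Hom_Obj(2)[OF h(1)]]] by metis
  qed
  then obtain A B v where h: "w \<in> Hom C A B" "v \<in> Hom C B A"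
    and "left_rel C W (v \<cdot> w) (Id C A)" "left_rel C W (w \<cdot> v) (Id C B)" by blast
  then have "Q.cls (v \<cdot> w) = Q.cls (Id C A)" "Q.cls (w \<cdot> v) = Q.cls (Id C B)"
    using HomD(1)[OF Comp_in_Hom[OF h]] HomD(1)[OF Comp_in_Hom[OF h(2,1)]]
    by (simp_all add: Q.cls_eq)
  then have "inverse_arrows Q.quotient (Q.cls w) (Q.cls v)"
    unfolding inverse_arrows_def
    using h[THEN Q.cls_Hom] Q.cls_Comp[OF h] Q.cls_Comp[OF h(2,1)]
    by (auto simp: Q.quotient_Id)
  then show ?thesis by (auto simp: isomorphism_def)
qed

lemma split_comps_isomorphism_quotient:
  assumes cong: "category_congruence C (left_rel C W)"
  shows "w \<in> split_comps C W \<Longrightarrow> isomorphism (category_congruence.quotient C (left_rel C W))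
    (category_congruence.cls (left_rel C W) w)"
proof (induction rule: split_comps.induct)
  case (single f)
  then show ?case by (rule splits_isomorphism_quotient[OF cong])
next
  case (comp f A B g D)
  interpret Q: category_congruence C "left_rel C W" by (rule cong)
  show ?case
    using category.isomorphism_Comp[OF Q.quotient_category Q.cls_Hom[OF comp(2)] comp.IH
        Q.cls_Hom[OF comp(3)] splits_isomorphism_quotient[OF cong comp(4,5)]]
    by (simp add: Q.cls_Comp[OF comp(2,3)])
qed

lemma homotopy_rel_imp_left_rel:
  assumes sg: "split_generated C W" and cf: "common_fork C W" and fg: "homotopy_rel C W f g"
  shows "left_rel C W f g"
proof (rule category_congruence.loc_eq_imp_R[OF left_rel_congruence[OF cf]])
  show "isomorphism (category_congruence.quotient C (left_rel C W))
      (category_congruence.cls (left_rel C W) w)" if "w \<in> W" for w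
    using split_comps_isomorphism_quotient[OF left_rel_congruence[OF cf]] sg that
    by (auto simp: split_generated_def)
qed (use fg in \<open>auto simp: homotopy_rel_def Hom_def\<close>)

end

theorem corollary3p3p6:
  fixes C :: "('o, 'a) cat" and W :: "'a set"
  assumes "weq_category C W"
    and "split_generated C W"
    and "common_fork C W"
  shows "homotopy_rel C W = left_rel C W \<and> homotopy_rel C W = right_rel C W"
proof -
  interpret weq_category C W by fact
  have "homotopy_rel C W = left_rel C W"
    using left_rel_imp_homotopy_rel homotopy_rel_imp_left_rel[OF assms(2,3)] by blast
  then show ?thesis using left_rel_eq_right_rel[OF assms(3)] by simp
qed

end
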